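(* Let $X$ be an arbitrary Hilbert space (as a matter of fact, the result is valid for any Banach space $X$), and equip $cabv(X)$ with the variational norm. Let $(\omega_i)_{i\geq1}\subset Lip(T)$ have Lipschitz constants $r_i=\|\omega_i\|_L$ forming a bounded sequence, and let $(R_i)_{i\geq1}\subset\mathcal{L}(X)$ be such that $\sum_{i=1}^{\infty}\|R_i\|_o<\infty$. Let $H:cabv(X)\to cabv(X)$ be given by $H(\mu)=\sum_{i=1}^{\infty}R_i\circ\omega_i(\mu)$. Let $\mu^0\in cabv(X)$. Assume: (a) $e=\sum_{i=1}^{\infty}\|R_i\|_o<1$; (b) $\emptyset\neq A\subseteq cabv(X)$ is a closed set such that $H(\mu)+\mu^0\in A$ for any $\mu\in A$. (In particular, one can take $A=cabv(X)$, or one can take $A=B_a(X)$ if $0<a<\infty$ and $\|\mu^0\|+a\sum_{i=1}^{\infty}\|R_i\|_o\leq a$.) Under these hypotheses, define $H_2:A\to A$ via $H_2(\mu)=H(\mu)+\mu^0$ for any $\mu\in A$. Then $H_2$ is a contraction with contraction factor $\leq e$ (for the metric given by the variational norm). Moreover: (i) if $\mu^0=0$, then $0\in A$; (ii) there exists a unique $\mu^{\ast}\in A$ such that $H_2(\mu^{\ast})=\mu^{\ast}$; in case $\mu^0=0$, we have $\mu^{\ast}=0$.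
   Context: All vector spaces are non-null and over $K=\mathbb{R}$ or $\mathbb{C}$. $(T,d)$ is a compact metric space with at least two elements, $\mathcal{B}$ its Borel $\sigma$-algebra. $Lip(T)$ is the set of Lipschitz maps $T\to T$; $\|\omega\|_L$ is the (least) Lipschitz constant of $\omega$. A contraction is a Lipschitz self-map of a metric space with Lipschitz constant $<1$; this constant is its contraction factor. $\mathcal{L}(X)$ is the space of continuous linear operators on $X$, with operator norm $\|\cdot\|_o$. $cabv(X)$ is the Banach space of $\sigma$-additive $\mu:\mathcal{B}\to X$ with finite total variation, with the variational norm $\|\mu\|=|\mu|(T)=\sup\sum_i\|\mu(A_i)\|$ (supremum over finite Borel partitions $(A_i)$ of $T$). For continuous $h:T\to T$, $h(\mu)(B)=\mu(h^{-1}(B))$ for $B\in\mathcal{B}$; for $R\in\mathcal{L}(X)$, $(R\circ h(\mu))(B)=R(\mu(h^{-1}(B)))$. The series defining $H(\mu)$ converges absolutely in $cabv(X)$. $B_a(X)=\{\mu\in cabv(X):\|\mu\|\leq a\}$. *)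

theory Defs
  imports "HOL-Analysis.Analysis"
begin

section \<open>Lipschitz constants and contractions\<close>

definition lipschitz_const :: "'a::metric_space set \<Rightarrow> ('a \<Rightarrow> 'b::metric_space) \<Rightarrow> real" where
  "lipschitz_const U f = Inf {C. C-lipschitz_on U f}"

definition is_contraction_on :: "'a::metric_space set \<Rightarrow> ('a \<Rightarrow> 'a) \<Rightarrow> bool" where
  "is_contraction_on U f \<longleftrightarrow>
     f \<in> U \<rightarrow> U \<and> (\<exists>C. C-lipschitz_on U f) \<and> lipschitz_const U f < 1"


section \<open>Vector measures of bounded variation\<close>

definition finite_borel_partitions :: "'t::topological_space set set set" where
  "finite_borel_partitions = {P. finite P \<and> P \<subseteq> sets borel \<and> partition_on UNIV P}"

text \<open>A set function on the Borel sets is represented by a function on all sets that vanishes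
  outside the Borel sets, so that equality of representatives is equality on the Borel sets.
  Only the real structure of the target space is used: a complex Banach space is treated as the
  underlying real one, which has the same measures, variational norm and operator norms.\<close>

definition cabv :: "('t::topological_space set \<Rightarrow> 'x::real_normed_vector) set" where
  "cabv = {\<mu>. (\<forall>B. B \<notin> sets borel \<longrightarrow> \<mu> B = 0) \<and>
     (\<forall>A :: nat \<Rightarrow> 't set. range A \<subseteq> sets borel \<longrightarrow> disjoint_family A \<longrightarrow>
        (\<lambda>i. \<mu> (A i)) sums \<mu> (\<Union>i. A i)) \<and>
     bdd_above ((\<lambda>P. \<Sum>A\<in>P. norm (\<mu> A)) ` finite_borel_partitions)}"

definition total_variation :: "('t::topological_space set \<Rightarrow> 'x::real_normed_vector) \<Rightarrow> real" where
  "total_variation \<mu> = (SUP P\<in>finite_borel_partitions. \<Sum>A\<in>P. norm (\<mu> A))"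

lemma fbp_UNIV: "{UNIV} \<in> finite_borel_partitions"
  by (auto simp: finite_borel_partitions_def partition_on_def)

lemma fbp_nonempty: "finite_borel_partitions \<noteq> {}"
  using fbp_UNIV by blast

lemma cabv_empty:
  assumes "\<mu> \<in> cabv" shows "\<mu> {} = 0"
proof -
  have "(\<lambda>i::nat. \<mu> {}) sums \<mu> (\<Union>i::nat. {})"
    using assms unfolding cabv_def by (auto simp: disjoint_family_on_def dest!: spec[of _ "\<lambda>_::nat. {}"])
  then have "(\<lambda>i::nat. \<mu> {}) \<longlonglongrightarrow> 0"
    by (intro summable_LIMSEQ_zero) (auto simp: summable_def)
  then show ?thesis by (simp add: LIMSEQ_const_iff)
qed

lemma cabv_sums:
  assumes "\<mu> \<in> cabv" "range A \<subseteq> sets borel" "disjoint_family A"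
  shows "(\<lambda>i::nat. \<mu> (A i)) sums \<mu> (\<Union>i. A i)"
  using assms unfolding cabv_def by blast

lemma sum_le_total_variation:
  assumes "\<mu> \<in> cabv" "P \<in> finite_borel_partitions"
  shows "(\<Sum>A\<in>P. norm (\<mu> A)) \<le> total_variation \<mu>"
  using assms unfolding cabv_def total_variation_def by (auto intro!: cSUP_upper2)

lemma total_variation_le:
  assumes "\<And>P. P \<in> finite_borel_partitions \<Longrightarrow> (\<Sum>A\<in>P. norm (\<mu> A)) \<le> c"
  shows "total_variation \<mu> \<le> c"
  unfolding total_variation_def using assms fbp_nonempty by (intro cSUP_least) auto

lemma cabvI:
  assumes "\<And>B. B \<notin> sets borel \<Longrightarrow> \<mu> B = 0"
    and "\<And>A. range A \<subseteq> sets borel \<Longrightarrow> disjoint_family A \<Longrightarrow>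
           (\<lambda>i::nat. \<mu> (A i)) sums \<mu> (\<Union>i. A i)"
    and "\<And>P. P \<in> finite_borel_partitions \<Longrightarrow> (\<Sum>A\<in>P. norm (\<mu> A)) \<le> c"
  shows "\<mu> \<in> cabv"
  using assms unfolding cabv_def by (auto intro!: bdd_aboveI2[where M=c])

lemma norm_le_total_variation:
  assumes "\<mu> \<in> cabv"
  shows "norm (\<mu> B) \<le> total_variation \<mu>"
proof (cases "B \<in> sets borel")
  case True
  have P: "{B, - B} - {{}} \<in> finite_borel_partitions"
    using True borel_comp[OF True]
    by (auto simp: finite_borel_partitions_def partition_on_def disjoint_def)
  have "norm (\<mu> B) \<le> (\<Sum>A\<in>{B, - B} - {{}}. norm (\<mu> A))"
  proof (cases "B = {}")
    case True
    then show ?thesis using cabv_empty[OF assms] by (simp add: sum_nonneg)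
  next
    case False
    then show ?thesis by (intro member_le_sum) auto
  qed
  then show ?thesis using sum_le_total_variation[OF assms P] by linarith
next
  case False
  then have "\<mu> B = 0" using assms by (auto simp: cabv_def)
  moreover have "norm (\<mu> UNIV) \<le> total_variation \<mu>"
    using sum_le_total_variation[OF assms fbp_UNIV] by simp
  ultimately show ?thesis by (auto intro: order_trans[OF norm_ge_zero])
qed

lemma cabv_zero: "(\<lambda>_. 0) \<in> cabv"
  by (rule cabvI[where c=0]) auto

lemma cabv_lincomb:
  assumes "\<mu> \<in> cabv" "\<nu> \<in> cabv"
  shows "(\<lambda>B. a *\<^sub>R \<mu> B + b *\<^sub>R \<nu> B) \<in> cabv"
proof (rule cabvI)
  fix P :: "'a set set" assume P: "P \<in> finite_borel_partitions"
  have "(\<Sum>A\<in>P. norm (a *\<^sub>R \<mu> A + b *\<^sub>R \<nu> A)) \<le>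
      (\<Sum>A\<in>P. \<bar>a\<bar> * norm (\<mu> A) + \<bar>b\<bar> * norm (\<nu> A))"
    by (intro sum_mono norm_triangle_le) simp
  also have "\<dots> = \<bar>a\<bar> * (\<Sum>A\<in>P. norm (\<mu> A)) + \<bar>b\<bar> * (\<Sum>A\<in>P. norm (\<nu> A))"
    by (simp add: sum.distrib sum_distrib_left)
  also have "\<dots> \<le> \<bar>a\<bar> * total_variation \<mu> + \<bar>b\<bar> * total_variation \<nu>"
    using assms P by (intro add_mono mult_left_mono sum_le_total_variation) auto
  finally show "(\<Sum>A\<in>P. norm (a *\<^sub>R \<mu> A + b *\<^sub>R \<nu> A)) \<le>
    \<bar>a\<bar> * total_variation \<mu> + \<bar>b\<bar> * total_variation \<nu>" .
next
  show "(\<lambda>i. a *\<^sub>R \<mu> (A i) + b *\<^sub>R \<nu> (A i)) sums (a *\<^sub>R \<mu> (\<Union>i. A i) + b *\<^sub>R \<nu> (\<Union>i. A i))"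
    if "range A \<subseteq> sets borel" "disjoint_family A" for A :: "nat \<Rightarrow> 'a set"
    using assms that by (intro sums_add sums_scaleR_right cabv_sums)
qed (use assms in \<open>auto simp: cabv_def\<close>)

typedef (overloaded) ('t, 'x) cabv =
  "cabv :: ('t::topological_space set \<Rightarrow> 'x::real_normed_vector) set"
  morphisms apply_cabv Abs_cabv
  using cabv_zero by blast

setup_lifting type_definition_cabv

lemma cabv_eqI: "(\<And>B. apply_cabv \<mu> B = apply_cabv \<nu> B) \<Longrightarrow> \<mu> = \<nu>"
  by transfer auto

instantiation cabv :: (topological_space, real_normed_vector) real_vector
begin

lift_definition zero_cabv :: "('a, 'b) cabv" is "\<lambda>_. 0"
  by (rule cabv_zero)

lift_definition plus_cabv :: "('a, 'b) cabv \<Rightarrow> ('a, 'b) cabv \<Rightarrow> ('a, 'b) cabv"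
  is "\<lambda>\<mu> \<nu> B. \<mu> B + \<nu> B"
  using cabv_lincomb[where a=1 and b=1] by simp

lift_definition minus_cabv :: "('a, 'b) cabv \<Rightarrow> ('a, 'b) cabv \<Rightarrow> ('a, 'b) cabv"
  is "\<lambda>\<mu> \<nu> B. \<mu> B - \<nu> B"
  using cabv_lincomb[where a=1 and b="-1"] by simp

lift_definition uminus_cabv :: "('a, 'b) cabv \<Rightarrow> ('a, 'b) cabv" is "\<lambda>\<mu> B. - \<mu> B"
  using cabv_lincomb[where a="-1" and b=0] by fastforce

lift_definition scaleR_cabv :: "real \<Rightarrow> ('a, 'b) cabv \<Rightarrow> ('a, 'b) cabv" is "\<lambda>a \<mu> B. a *\<^sub>R \<mu> B"
  using cabv_lincomb[where b=0] by fastforce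

instance
  by standard (transfer; force simp: algebra_simps)+

end

lemmas [simp] =
  zero_cabv.rep_eq plus_cabv.rep_eq minus_cabv.rep_eq uminus_cabv.rep_eq scaleR_cabv.rep_eq

instantiation cabv :: (topological_space, real_normed_vector) real_normed_vector
begin

lift_definition norm_cabv :: "('a, 'b) cabv \<Rightarrow> real" is total_variation .

definition dist_cabv :: "('a, 'b) cabv \<Rightarrow> ('a, 'b) cabv \<Rightarrow> real"
  where "dist_cabv \<mu> \<nu> = norm (\<mu> - \<nu>)"

definition sgn_cabv :: "('a, 'b) cabv \<Rightarrow> ('a, 'b) cabv"
  where "sgn_cabv \<mu> = \<mu> /\<^sub>R norm \<mu>"

definition uniformity_cabv :: "(('a, 'b) cabv \<times> ('a, 'b) cabv) filter"
  where "uniformity_cabv = (INF e\<in>{0 <..}. principal {(x, y). dist x y < e})"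

definition open_cabv :: "('a, 'b) cabv set \<Rightarrow> bool"
  where "open_cabv S = (\<forall>x\<in>S. \<forall>\<^sub>F (x', y) in uniformity. x' = x \<longrightarrow> y \<in> S)"

instance
proof
  fix \<mu> \<nu> :: "('a, 'b) cabv" and a :: real
  have zero: "norm (0::('a, 'b) cabv) = 0"
    by transfer (simp add: total_variation_def fbp_nonempty)
  show "norm \<mu> = 0 \<longleftrightarrow> \<mu> = 0"
  proof
    assume "norm \<mu> = 0"
    then show "\<mu> = 0"
    proof transfer
      fix \<mu> :: "'a set \<Rightarrow> 'b" assume "\<mu> \<in> cabv" "total_variation \<mu> = 0"
      then show "\<mu> = (\<lambda>_. 0)" using norm_le_total_variation[of \<mu>] by (intro ext) simp
    qed
  qed (simp add: zero)
  show "norm (\<mu> + \<nu>) \<le> norm \<mu> + norm \<nu>"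
  proof transfer
    fix \<mu> \<nu> :: "'a set \<Rightarrow> 'b" assume *: "\<mu> \<in> cabv" "\<nu> \<in> cabv"
    show "total_variation (\<lambda>B. \<mu> B + \<nu> B) \<le> total_variation \<mu> + total_variation \<nu>"
    proof (rule total_variation_le)
      fix P :: "'a set set" assume P: "P \<in> finite_borel_partitions"
      have "(\<Sum>A\<in>P. norm (\<mu> A + \<nu> A)) \<le> (\<Sum>A\<in>P. norm (\<mu> A)) + (\<Sum>A\<in>P. norm (\<nu> A))"
        by (simp add: norm_triangle_ineq sum_mono flip: sum.distrib)
      then show "(\<Sum>A\<in>P. norm (\<mu> A + \<nu> A)) \<le> total_variation \<mu> + total_variation \<nu>"
        using sum_le_total_variation[OF *(1) P] sum_le_total_variation[OF *(2) P] by linarith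
    qed
  qed
  have scale_le: "norm (c *\<^sub>R \<rho>) \<le> \<bar>c\<bar> * norm \<rho>" for c and \<rho> :: "('a, 'b) cabv"
  proof transfer
    fix c :: real and \<rho> :: "'a set \<Rightarrow> 'b" assume *: "\<rho> \<in> cabv"
    show "total_variation (\<lambda>B. c *\<^sub>R \<rho> B) \<le> \<bar>c\<bar> * total_variation \<rho>"
      by (rule total_variation_le)
        (auto simp: * simp flip: sum_distrib_left intro!: mult_left_mono sum_le_total_variation)
  qed
  show "norm (a *\<^sub>R \<mu>) = \<bar>a\<bar> * norm \<mu>"
  proof (cases "a = 0")
    case True
    have "0 *\<^sub>R \<mu> = 0" by transfer simp
    then show ?thesis using True zero by simp
  next
    case False
    have "inverse a *\<^sub>R (a *\<^sub>R \<mu>) = \<mu>" using False by transfer simp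
    then have "norm \<mu> \<le> \<bar>inverse a\<bar> * norm (a *\<^sub>R \<mu>)"
      using scale_le[of "inverse a" "a *\<^sub>R \<mu>"] by simp
    then have "\<bar>a\<bar> * norm \<mu> \<le> norm (a *\<^sub>R \<mu>)"
      using False by (simp add: field_simps abs_inverse)
    then show ?thesis using scale_le[of a \<mu>] by simp
  qed
qed (simp_all add: dist_cabv_def sgn_cabv_def uniformity_cabv_def open_cabv_def)

end

lemma norm_apply_cabv_le: "norm (apply_cabv \<mu> B) \<le> norm \<mu>"
  by transfer (rule norm_le_total_variation)

lemma sum_le_norm_cabv:
  "P \<in> finite_borel_partitions \<Longrightarrow> (\<Sum>A\<in>P. norm (apply_cabv \<mu> A)) \<le> norm \<mu>"
  by transfer (rule sum_le_total_variation)

lemma norm_cabv_le: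
  "(\<And>P. P \<in> finite_borel_partitions \<Longrightarrow> (\<Sum>A\<in>P. norm (apply_cabv \<mu> A)) \<le> c) \<Longrightarrow> norm \<mu> \<le> c"
  by transfer (rule total_variation_le)

lemma apply_cabv_finite_Un:
  fixes A :: "nat \<Rightarrow> 't::topological_space set"
  assumes "range A \<subseteq> sets borel" "disjoint_family A"
  shows "apply_cabv \<mu> (\<Union>i<k. A i) = (\<Sum>i<k. apply_cabv \<mu> (A i))"
proof -
  let ?A = "\<lambda>i. if i < k then A i else {}"
  have "(\<lambda>i. apply_cabv \<mu> (?A i)) sums apply_cabv \<mu> (\<Union>i. ?A i)"
    using assms by (intro cabv_sums apply_cabv) (auto simp: disjoint_family_on_def)
  moreover have "(\<Union>i. ?A i) = (\<Union>i<k. A i)" by (auto split: if_splits)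
  moreover have "(\<lambda>i. apply_cabv \<mu> (?A i)) sums (\<Sum>i<k. apply_cabv \<mu> (?A i))"
    by (rule sums_finite) (auto simp: cabv_empty[OF apply_cabv])
  ultimately show ?thesis by (auto dest: sums_unique2)
qed

instance cabv :: (topological_space, banach) banach
proof
  fix X :: "nat \<Rightarrow> ('a, 'b) cabv"
  assume X: "Cauchy X"
  have "\<exists>l. (\<lambda>n. apply_cabv (X n) B) \<longlonglongrightarrow> l" for B
  proof -
    have "Cauchy (\<lambda>n. apply_cabv (X n) B)"
    proof (rule CauchyI)
      fix e :: real assume "0 < e"
      then obtain M where M: "\<And>m n. m \<ge> M \<Longrightarrow> n \<ge> M \<Longrightarrow> norm (X m - X n) < e"
        using CauchyD[OF X] by blast
      show "\<exists>M. \<forall>m\<ge>M. \<forall>n\<ge>M. norm (apply_cabv (X m) B - apply_cabv (X n) B) < e"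
      proof (intro exI allI impI)
        fix m n assume "m \<ge> M" "n \<ge> M"
        then show "norm (apply_cabv (X m) B - apply_cabv (X n) B) < e"
          using M[of m n] norm_apply_cabv_le[of "X m - X n" B] by simp
      qed
    qed
    then show ?thesis by (simp add: Cauchy_convergent_iff convergent_def)
  qed
  then obtain L where L: "\<And>B. (\<lambda>n. apply_cabv (X n) B) \<longlonglongrightarrow> L B"
    by metis
  have var: "\<exists>N. \<forall>n\<ge>N. \<forall>P\<in>finite_borel_partitions. (\<Sum>A\<in>P. norm (L A - apply_cabv (X n) A)) \<le> e"
    if "0 < e" for e :: real
  proof -
    obtain N where N: "\<And>m n. m \<ge> N \<Longrightarrow> n \<ge> N \<Longrightarrow> norm (X m - X n) < e"
      using CauchyD[OF X \<open>0 < e\<close>] by blast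
    have "(\<Sum>A\<in>P. norm (L A - apply_cabv (X n) A)) \<le> e"
      if "n \<ge> N" "P \<in> finite_borel_partitions" for n P
    proof (rule tendsto_upperbound)
      show "(\<lambda>m. \<Sum>A\<in>P. norm (apply_cabv (X m) A - apply_cabv (X n) A)) \<longlonglongrightarrow>
          (\<Sum>A\<in>P. norm (L A - apply_cabv (X n) A))"
        by (intro tendsto_intros L)
      show "\<forall>\<^sub>F m in sequentially. (\<Sum>A\<in>P. norm (apply_cabv (X m) A - apply_cabv (X n) A)) \<le> e"
        using eventually_ge_at_top[of N]
      proof eventually_elim
        case (elim m)
        show ?case using N[OF elim \<open>n \<ge> N\<close>] sum_le_norm_cabv[OF that(2), of "X m - X n"] by simp
      qed
    qed simp
    then show ?thesis by blast
  qed
  have unif: "uniform_limit UNIV (\<lambda>n B. apply_cabv (X n) B) L sequentially"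
  proof (rule uniform_limitI)
    fix e :: real assume "0 < e"
    obtain N where N: "\<And>m n. m \<ge> N \<Longrightarrow> n \<ge> N \<Longrightarrow> norm (X m - X n) < e/2"
      using CauchyD[OF X, of "e/2"] \<open>0 < e\<close> by auto
    have "norm (L B - apply_cabv (X n) B) \<le> e/2" if "n \<ge> N" for n B
    proof (rule tendsto_upperbound)
      show "(\<lambda>m. norm (apply_cabv (X m) B - apply_cabv (X n) B)) \<longlonglongrightarrow> norm (L B - apply_cabv (X n) B)"
        by (intro tendsto_intros L)
      show "\<forall>\<^sub>F m in sequentially. norm (apply_cabv (X m) B - apply_cabv (X n) B) \<le> e/2"
        using eventually_ge_at_top[of N]
      proof eventually_elim
        case (elim m)
        show ?case using N[OF elim \<open>n \<ge> N\<close>] norm_apply_cabv_le[of "X m - X n" B] by simp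
      qed
    qed simp
    then have "dist (apply_cabv (X n) B) (L B) \<le> e/2" if "n \<ge> N" for n B
      using that by (simp add: dist_norm norm_minus_commute)
    moreover have "e/2 < e" using \<open>0 < e\<close> by simp
    ultimately have "dist (apply_cabv (X n) B) (L B) < e" if "n \<ge> N" for n B
      using that by (meson le_less_trans)
    then show "\<forall>\<^sub>F n in sequentially. \<forall>B\<in>UNIV. dist (apply_cabv (X n) B) (L B) < e"
      unfolding eventually_sequentially by blast
  qed
  obtain N where N: "\<And>P. P \<in> finite_borel_partitions \<Longrightarrow>
      (\<Sum>A\<in>P. norm (L A - apply_cabv (X N) A)) \<le> 1"
    using var[of 1] by auto
  have "L \<in> cabv"
  proof (rule cabvI)
    fix B :: "'a set" assume "B \<notin> sets borel"
    then have "apply_cabv (X n) B = 0" for n using apply_cabv[of "X n"] by (auto simp: cabv_def)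
    then show "L B = 0" using L[of B] by (simp add: LIMSEQ_const_iff)
  next
    fix A :: "nat \<Rightarrow> 'a set" assume A: "range A \<subseteq> sets borel" "disjoint_family A"
    have fin: "L (\<Union>i<k. A i) = (\<Sum>i<k. L (A i))" for k
    proof (rule LIMSEQ_unique[OF L])
      show "(\<lambda>n. apply_cabv (X n) (\<Union>i<k. A i)) \<longlonglongrightarrow> (\<Sum>i<k. L (A i))"
        unfolding apply_cabv_finite_Un[OF A] by (intro tendsto_intros L)
    qed
    have "((\<lambda>k. L (\<Union>i<k. A i)) \<longlongrightarrow> L (\<Union>i. A i)) sequentially"
    proof (rule swap_uniform_limit'[where f="\<lambda>n k. apply_cabv (X n) (\<Union>i<k. A i)" and S=UNIV and F=sequentially])
      show "\<forall>\<^sub>F n in sequentially.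
          ((\<lambda>k. apply_cabv (X n) (\<Union>i<k. A i)) \<longlongrightarrow> apply_cabv (X n) (\<Union>i. A i)) sequentially"
        using cabv_sums[OF apply_cabv A] unfolding apply_cabv_finite_Un[OF A] sums_def
        by (intro always_eventually allI)
      show "uniform_limit UNIV (\<lambda>n k. apply_cabv (X n) (\<Union>i<k. A i)) (\<lambda>k. L (\<Union>i<k. A i)) sequentially"
        using unif unfolding uniform_limit_iff by (auto elim!: eventually_mono)
    qed (auto intro: L)
    then show "(\<lambda>i. L (A i)) sums L (\<Union>i. A i)"
      by (simp add: fin sums_def)
  next
    fix P :: "'a set set" assume P: "P \<in> finite_borel_partitions"
    have "(\<Sum>A\<in>P. norm (L A)) \<le>
        (\<Sum>A\<in>P. norm (L A - apply_cabv (X N) A) + norm (apply_cabv (X N) A))"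
      by (intro sum_mono) (metis add.commute norm_triangle_sub)
    also have "\<dots> \<le> 1 + norm (X N)"
      using N[OF P] sum_le_norm_cabv[OF P, of "X N"] by (simp add: sum.distrib)
    finally show "(\<Sum>A\<in>P. norm (L A)) \<le> 1 + norm (X N)" .
  qed
  then obtain l where l: "L = apply_cabv l" by (metis Abs_cabv_inverse)
  have "X \<longlonglongrightarrow> l"
  proof (rule LIMSEQ_I)
    fix e :: real assume "0 < e"
    then obtain N where N: "\<And>n P. n \<ge> N \<Longrightarrow> P \<in> finite_borel_partitions \<Longrightarrow>
        (\<Sum>A\<in>P. norm (L A - apply_cabv (X n) A)) \<le> e/2"
      using var[of "e/2"] by auto
    have "norm (X n - l) < e" if "n \<ge> N" for n
    proof -
      have "norm (l - X n) \<le> e/2" using N[OF that] by (intro norm_cabv_le) (simp add: l)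
      then show ?thesis using \<open>0 < e\<close> by (simp add: norm_minus_commute)
    qed
    then show "\<exists>N. \<forall>n\<ge>N. norm (X n - l) < e" by blast
  qed
  then show "convergent X" by (rule convergentI)
qed


section \<open>The operators on vector measures\<close>

lemma fbp_vimage:
  fixes h :: "'t::topological_space \<Rightarrow> 't"
  assumes "h \<in> borel_measurable borel" "P \<in> finite_borel_partitions"
  shows "(-`) h ` P - {{}} \<in> finite_borel_partitions"
  using assms partition_on_vimage[of UNIV P h]
  by (auto simp: finite_borel_partitions_def dest: measurable_sets)

lemma sum_vimage_le:
  fixes h :: "'t::topological_space \<Rightarrow> 't"
  assumes "\<mu> \<in> cabv" "h \<in> borel_measurable borel" "P \<in> finite_borel_partitions"
  shows "(\<Sum>A\<in>P. norm (\<mu> (h -` A))) \<le> total_variation \<mu>"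
proof -
  let ?Q = "{A\<in>P. h -` A \<noteq> {}}"
  have P: "finite P" "disjoint P"
    using assms(3) by (auto simp: finite_borel_partitions_def partition_on_def)
  have inj: "inj_on ((-`) h) ?Q"
  proof (rule inj_onI)
    fix x y assume "x \<in> ?Q" "y \<in> ?Q" "h -` x = h -` y"
    moreover from this obtain t where "h t \<in> x" "h t \<in> y" by blast
    ultimately show "x = y" using P(2) by (auto simp: disjoint_def)
  qed
  have "(\<Sum>A\<in>P. norm (\<mu> (h -` A))) = (\<Sum>A\<in>?Q. norm (\<mu> (h -` A)))"
    using P(1) cabv_empty[OF assms(1)] by (intro sum.mono_neutral_right) auto
  also have "\<dots> = (\<Sum>A\<in>(-`) h ` ?Q. norm (\<mu> A))"
    by (simp add: sum.reindex[OF inj])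
  also have "(-`) h ` ?Q = (-`) h ` P - {{}}" by auto
  finally show ?thesis
    using sum_le_total_variation[OF assms(1) fbp_vimage[OF assms(2,3)]] by simp
qed

text \<open>Image measure \<open>h(\<mu>)\<close> for continuous \<open>h\<close>; for discontinuous \<open>h\<close> the value is the
  dummy \<open>0\<close>.\<close>

lift_definition cabv_image ::
  "('t::topological_space \<Rightarrow> 't) \<Rightarrow> ('t, 'x::real_normed_vector) cabv \<Rightarrow> ('t, 'x) cabv"
  is "\<lambda>h \<mu> B. if continuous_on UNIV h \<and> B \<in> sets borel then \<mu> (h -` B) else 0"
proof -
  fix h :: "'t \<Rightarrow> 't" and \<mu> :: "'t set \<Rightarrow> 'x" assume \<mu>: "\<mu> \<in> cabv"
  show "(\<lambda>B. if continuous_on UNIV h \<and> B \<in> sets borel then \<mu> (h -` B) else 0) \<in> cabv"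
  proof (cases "continuous_on UNIV h")
    case True
    then have h: "h \<in> borel_measurable borel" by (rule borel_measurable_continuous_onI)
    show ?thesis
    proof (rule cabvI)
      fix A :: "nat \<Rightarrow> 't set" assume A: "range A \<subseteq> sets borel" "disjoint_family A"
      have "(\<lambda>i. \<mu> (h -` A i)) sums \<mu> (\<Union>i. h -` A i)"
      proof (rule cabv_sums[OF \<mu>])
        show "range (\<lambda>i. h -` A i) \<subseteq> sets borel"
          using A(1) measurable_sets[OF h] by (auto simp: image_subset_iff)
        show "disjoint_family (\<lambda>i. h -` A i)"
          using A(2) unfolding disjoint_family_on_def by blast
      qed
      then show "(\<lambda>i. if continuous_on UNIV h \<and> A i \<in> sets borel then \<mu> (h -` A i) else 0) sums
        (if continuous_on UNIV h \<and> (\<Union>i. A i) \<in> sets borel then \<mu> (h -` (\<Union>i. A i)) else 0)"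
        using A True by (auto simp: vimage_UN image_subset_iff)
    next
      fix P :: "'t set set" assume P: "P \<in> finite_borel_partitions"
      then have "(\<Sum>A\<in>P. norm (if continuous_on UNIV h \<and> A \<in> sets borel then \<mu> (h -` A) else 0)) =
          (\<Sum>A\<in>P. norm (\<mu> (h -` A)))"
        using True by (intro sum.cong) (auto simp: finite_borel_partitions_def)
      then show "(\<Sum>A\<in>P. norm (if continuous_on UNIV h \<and> A \<in> sets borel then \<mu> (h -` A) else 0))
          \<le> total_variation \<mu>"
        using sum_vimage_le[OF \<mu> h P] by simp
    qed auto
  qed (simp add: cabv_zero)
qed

lift_definition cabv_comp ::
  "('x::real_normed_vector \<Rightarrow>\<^sub>L 'x) \<Rightarrow> ('t::topological_space, 'x) cabv \<Rightarrow> ('t, 'x) cabv"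
  is "\<lambda>R \<mu> B. blinfun_apply R (\<mu> B)"
proof -
  fix R :: "'x \<Rightarrow>\<^sub>L 'x" and \<mu> :: "'t set \<Rightarrow> 'x" assume \<mu>: "\<mu> \<in> cabv"
  show "(\<lambda>B. blinfun_apply R (\<mu> B)) \<in> cabv"
  proof (rule cabvI)
    fix P :: "'t set set" assume P: "P \<in> finite_borel_partitions"
    have "(\<Sum>A\<in>P. norm (blinfun_apply R (\<mu> A))) \<le> (\<Sum>A\<in>P. norm R * norm (\<mu> A))"
      by (intro sum_mono norm_blinfun)
    also have "\<dots> \<le> norm R * total_variation \<mu>"
      by (simp add: mult_left_mono sum_le_total_variation[OF \<mu> P] flip: sum_distrib_left)
    finally show "(\<Sum>A\<in>P. norm (blinfun_apply R (\<mu> A))) \<le> norm R * total_variation \<mu>" .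
  next
    show "(\<lambda>i. blinfun_apply R (\<mu> (A i))) sums blinfun_apply R (\<mu> (\<Union>i. A i))"
      if "range A \<subseteq> sets borel" "disjoint_family A" for A :: "nat \<Rightarrow> 't set"
      using cabv_sums[OF \<mu> that] by (rule bounded_linear.sums[OF blinfun.bounded_linear_right])
  qed (use \<mu> in \<open>simp add: cabv_def\<close>)
qed

lemma norm_cabv_image_le:
  fixes \<mu> :: "('t::topological_space, 'x::real_normed_vector) cabv"
  shows "norm (cabv_image h \<mu>) \<le> norm \<mu>"
proof (cases "continuous_on UNIV h")
  case True
  then have h: "h \<in> borel_measurable borel" by (rule borel_measurable_continuous_onI)
  show ?thesis
  proof (rule norm_cabv_le)
    fix P :: "'t set set" assume P: "P \<in> finite_borel_partitions"
    then have "(\<Sum>A\<in>P. norm (apply_cabv (cabv_image h \<mu>) A)) =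
        (\<Sum>A\<in>P. norm (apply_cabv \<mu> (h -` A)))"
      using True by (intro sum.cong) (auto simp: finite_borel_partitions_def cabv_image.rep_eq)
    then show "(\<Sum>A\<in>P. norm (apply_cabv (cabv_image h \<mu>) A)) \<le> norm \<mu>"
      using sum_vimage_le[OF apply_cabv h P, of \<mu>] by (simp add: norm_cabv.rep_eq)
  qed
next
  case False
  then have "cabv_image h \<mu> = 0" by (intro cabv_eqI) (simp add: cabv_image.rep_eq)
  then show ?thesis by simp
qed

lemma norm_cabv_comp_le: "norm (cabv_comp R \<mu>) \<le> norm R * norm \<mu>"
proof (rule norm_cabv_le)
  fix P :: "'a set set" assume P: "P \<in> finite_borel_partitions"
  have "(\<Sum>A\<in>P. norm (apply_cabv (cabv_comp R \<mu>) A)) \<le> (\<Sum>A\<in>P. norm R * norm (apply_cabv \<mu> A))"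
    by (intro sum_mono) (simp add: cabv_comp.rep_eq norm_blinfun)
  also have "\<dots> \<le> norm R * norm \<mu>"
    by (simp add: mult_left_mono sum_le_norm_cabv[OF P] flip: sum_distrib_left)
  finally show "(\<Sum>A\<in>P. norm (apply_cabv (cabv_comp R \<mu>) A)) \<le> norm R * norm \<mu>" .
qed

lemma summable_norm_cabv_comp_image:
  assumes "summable (\<lambda>i. norm (R i))"
  shows "summable (\<lambda>i. norm (cabv_comp (R i) (cabv_image (\<omega> i) \<mu>)))"
proof (rule summable_comparison_test)
  show "summable (\<lambda>i. norm (R i) * norm \<mu>)"
    using assms by (rule summable_mult2)
  have "norm (cabv_comp (R i) (cabv_image (\<omega> i) \<mu>)) \<le> norm (R i) * norm \<mu>" for i
    using norm_cabv_comp_le[of "R i" "cabv_image (\<omega> i) \<mu>"]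
      mult_left_mono[OF norm_cabv_image_le[of "\<omega> i" \<mu>], of "norm (R i)"] by simp
  then show "\<exists>N. \<forall>n\<ge>N. norm (norm (cabv_comp (R n) (cabv_image (\<omega> n) \<mu>))) \<le> norm (R n) * norm \<mu>"
    by auto
qed

end

theory Submission
  imports Defs
begin

text \<open>
  Taking image measures never increases the total variation, because the preimages of a partition
  again form a partition, and composing with \<open>R i\<close> multiplies it by at most \<open>norm (R i)\<close>.
  Summing the series gives \<open>norm (H \<mu>) \<le> e * norm \<mu>\<close>
  (\<open>norm_suminf_comp_image_le\<close>), and since \<open>H\<close> respects differences
  (\<open>suminf_comp_image_diff\<close>) this is a Lipschitz estimate: \<open>H\<close>, and with it every translate
  \<open>\<mu> \<mapsto> H \<mu> + \<mu>0\<close>, has Lipschitz constant at most \<open>e < 1\<close>.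

  The measures of bounded variation with values in a Banach space form a Banach space, so a closed
  set of them is complete and the Banach fixed point theorem yields the unique fixed point. If
  \<open>\<mu>0 = 0\<close>, the fixed point \<open>\<mu>\<close> satisfies \<open>norm \<mu> = norm (H \<mu>) \<le> e * norm \<mu>\<close>, which
  forces \<open>\<mu> = 0\<close>; in particular \<open>0\<close> belongs to the invariant set. The same norm estimate shows
  that the balls of the last claim are invariant.
\<close>

lemma lipschitz_const_le:
  assumes "C-lipschitz_on U f"
  shows "lipschitz_const U f \<le> C"
  unfolding lipschitz_const_def
  using assms by (intro cInf_lower) (auto intro!: bdd_belowI[of _ 0] dest: lipschitz_on_nonneg)

lemma cabv_image_diff: "cabv_image h (\<mu> - \<nu>) = cabv_image h \<mu> - cabv_image h \<nu>"
  by (rule cabv_eqI) (simp add: cabv_image.rep_eq)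

lemma cabv_comp_diff: "cabv_comp R (\<mu> - \<nu>) = cabv_comp R \<mu> - cabv_comp R \<nu>"
  by (rule cabv_eqI) (simp add: cabv_comp.rep_eq blinfun.diff_right)

lemma norm_comp_image_le: "norm (cabv_comp R (cabv_image h \<mu>)) \<le> norm R * norm \<mu>"
  by (rule order_trans[OF norm_cabv_comp_le]) (simp add: mult_left_mono norm_cabv_image_le)

lemma norm_suminf_comp_image_le:
  fixes R :: "nat \<Rightarrow> 'x::banach \<Rightarrow>\<^sub>L 'x"
  assumes "summable (\<lambda>i. norm (R i))"
  shows "norm (\<Sum>i. cabv_comp (R i) (cabv_image (\<omega> i) \<mu>)) \<le> (\<Sum>i. norm (R i)) * norm \<mu>"
proof -
  have "norm (\<Sum>i. cabv_comp (R i) (cabv_image (\<omega> i) \<mu>))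
      \<le> (\<Sum>i. norm (cabv_comp (R i) (cabv_image (\<omega> i) \<mu>)))"
    by (rule summable_norm[OF summable_norm_cabv_comp_image[OF assms]])
  also have "\<dots> \<le> (\<Sum>i. norm (R i) * norm \<mu>)"
    by (intro suminf_le norm_comp_image_le summable_norm_cabv_comp_image summable_mult2 assms)
  also have "\<dots> = (\<Sum>i. norm (R i)) * norm \<mu>"
    by (rule suminf_mult2[OF assms, symmetric])
  finally show ?thesis .
qed

lemma suminf_comp_image_diff:
  fixes R :: "nat \<Rightarrow> 'x::banach \<Rightarrow>\<^sub>L 'x"
  assumes "summable (\<lambda>i. norm (R i))"
  shows "(\<Sum>i. cabv_comp (R i) (cabv_image (\<omega> i) \<mu>)) - (\<Sum>i. cabv_comp (R i) (cabv_image (\<omega> i) \<nu>))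
    = (\<Sum>i. cabv_comp (R i) (cabv_image (\<omega> i) (\<mu> - \<nu>)))"
  unfolding cabv_image_diff cabv_comp_diff
  by (intro suminf_diff summable_norm_cancel[OF summable_norm_cabv_comp_image[OF assms]])

theorem theorem3p2p3:
  fixes \<omega> :: "nat \<Rightarrow> 't::metric_space \<Rightarrow> 't"
    and R :: "nat \<Rightarrow> 'x::banach \<Rightarrow>\<^sub>L 'x"
    and \<mu>0 :: "('t, 'x) cabv"
    and A :: "('t, 'x) cabv set"
    and H H2 :: "('t, 'x) cabv \<Rightarrow> ('t, 'x) cabv"
    and e :: real
  assumes T_compact: "compact (UNIV :: 't set)"
    and T_two: "\<exists>s t :: 't. s \<noteq> t"
    and X_nonnull: "\<exists>x :: 'x. x \<noteq> 0"
    and lip: "\<And>i. \<exists>C. C-lipschitz_on UNIV (\<omega> i)"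
    and lip_bounded: "bounded (range (\<lambda>i. lipschitz_const UNIV (\<omega> i)))"
    and R_summable: "summable (\<lambda>i. norm (R i))"
    and H: "\<And>\<mu>. H \<mu> = (\<Sum>i. cabv_comp (R i) (cabv_image (\<omega> i) \<mu>))"
    and e: "e = (\<Sum>i. norm (R i))" "e < 1"
    and A: "A \<noteq> {}" "closed A" "\<And>\<mu>. \<mu> \<in> A \<Longrightarrow> H \<mu> + \<mu>0 \<in> A"
    and H2: "\<And>\<mu>. H2 \<mu> = H \<mu> + \<mu>0"
  shows "is_contraction_on A H2 \<and> lipschitz_const A H2 \<le> e
    \<and> (\<mu>0 = 0 \<longrightarrow> 0 \<in> A)
    \<and> (\<exists>\<mu>s\<in>A. H2 \<mu>s = \<mu>s \<and> (\<forall>\<mu>\<in>A. H2 \<mu> = \<mu> \<longrightarrow> \<mu> = \<mu>s) \<and> (\<mu>0 = 0 \<longrightarrow> \<mu>s = 0))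
    \<and> ((UNIV :: ('t, 'x) cabv set) \<noteq> {} \<and> closed (UNIV :: ('t, 'x) cabv set)
        \<and> (\<forall>\<mu>. H \<mu> + \<mu>0 \<in> UNIV))
    \<and> (\<forall>a>0. norm \<mu>0 + a * (\<Sum>i. norm (R i)) \<le> a \<longrightarrow>
        {\<mu> :: ('t, 'x) cabv. norm \<mu> \<le> a} \<noteq> {} \<and> closed {\<mu> :: ('t, 'x) cabv. norm \<mu> \<le> a}
        \<and> (\<forall>\<mu>\<in>{\<mu>. norm \<mu> \<le> a}. H \<mu> + \<mu>0 \<in> {\<mu>. norm \<mu> \<le> a}))"
proof -
  have H_bound: "norm (H \<mu>) \<le> e * norm \<mu>" for \<mu>
    unfolding H e(1) by (rule norm_suminf_comp_image_le[OF R_summable])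
  have e_nonneg: "0 \<le> e"
    unfolding e(1) by (rule suminf_nonneg[OF R_summable]) simp
  have H2_dist: "dist (H2 \<mu>) (H2 \<nu>) \<le> e * dist \<mu> \<nu>" for \<mu> \<nu>
  proof -
    have "H2 \<mu> - H2 \<nu> = H (\<mu> - \<nu>)"
      using suminf_comp_image_diff[OF R_summable, of \<omega> \<mu> \<nu>] by (simp add: H2 H)
    then show ?thesis using H_bound[of "\<mu> - \<nu>"] by (simp add: dist_norm)
  qed
  have H2_A: "H2 \<in> A \<rightarrow> A" using A(3) by (simp add: H2)
  have H2_lip: "e-lipschitz_on A H2"
    by (rule lipschitz_onI[OF H2_dist e_nonneg])
  have const: "lipschitz_const A H2 \<le> e" by (rule lipschitz_const_le[OF H2_lip])
  have contraction: "is_contraction_on A H2"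
    using H2_A H2_lip const e(2) by (auto simp: is_contraction_on_def)
  have "\<exists>!\<mu>\<in>A. H2 \<mu> = \<mu>"
  proof (rule Banach_fix[OF _ A(1) e_nonneg e(2) _ H2_dist])
    show "complete A" using A(2) by (simp add: complete_eq_closed)
  qed (use H2_A in auto)
  then obtain \<mu>s where fix_point: "\<mu>s \<in> A" "H2 \<mu>s = \<mu>s"
      and unique: "\<And>\<mu>. \<mu> \<in> A \<Longrightarrow> H2 \<mu> = \<mu> \<Longrightarrow> \<mu> = \<mu>s"
    by blast
  have zero: "\<mu>s = 0" if "\<mu>0 = 0"
  proof -
    have "norm \<mu>s \<le> e * norm \<mu>s"
      using H_bound[of \<mu>s] fix_point(2) that by (simp add: H2)
    then have "(1 - e) * norm \<mu>s \<le> 0" by (simp add: algebra_simps)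
    then show ?thesis using e(2) by (simp add: mult_le_0_iff)
  qed
  have ball: "{\<mu> :: ('t, 'x) cabv. norm \<mu> \<le> a} \<noteq> {} \<and> closed {\<mu> :: ('t, 'x) cabv. norm \<mu> \<le> a}
      \<and> (\<forall>\<mu>\<in>{\<mu>. norm \<mu> \<le> a}. H \<mu> + \<mu>0 \<in> {\<mu>. norm \<mu> \<le> a})"
    if a: "a > 0" "norm \<mu>0 + a * (\<Sum>i. norm (R i)) \<le> a" for a
  proof (intro conjI ballI)
    have "0 \<in> {\<mu> :: ('t, 'x) cabv. norm \<mu> \<le> a}" using a(1) by simp
    then show "{\<mu> :: ('t, 'x) cabv. norm \<mu> \<le> a} \<noteq> {}" by blast
    show "closed {\<mu> :: ('t, 'x) cabv. norm \<mu> \<le> a}"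
      by (intro closed_Collect_le continuous_intros)
    fix \<mu> assume \<mu>: "\<mu> \<in> {\<mu> :: ('t, 'x) cabv. norm \<mu> \<le> a}"
    have "norm (H \<mu> + \<mu>0) \<le> e * norm \<mu> + norm \<mu>0"
      using norm_triangle_ineq[of "H \<mu>" \<mu>0] H_bound[of \<mu>] by linarith
    also have "\<dots> \<le> e * a + norm \<mu>0"
      using \<mu> e_nonneg by (simp add: mult_left_mono)
    also have "\<dots> \<le> a" using a(2) by (simp add: e(1) mult.commute)
    finally show "H \<mu> + \<mu>0 \<in> {\<mu>. norm \<mu> \<le> a}" by simp
  qed
  have zero_in_A: "\<mu>0 = 0 \<longrightarrow> 0 \<in> A"
    using zero fix_point(1) by auto
  have "\<exists>\<mu>s\<in>A. H2 \<mu>s = \<mu>s \<and> (\<forall>\<mu>\<in>A. H2 \<mu> = \<mu> \<longrightarrow> \<mu> = \<mu>s) \<and> (\<mu>0 = 0 \<longrightarrow> \<mu>s = 0)"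
    using fix_point unique zero by blast
  with contraction const zero_in_A ball show ?thesis
    by (intro conjI) simp_all
qed

end
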